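(* Let $C \subseteq \mathbb{R}^n$ be nonempty, closed, convex and line-free. For every $\nu \in \mathbb{N}$ let $P^{\nu}$ be an $(\varepsilon^{\nu},\delta^{\nu})$-approximation of $C$. If $(\varepsilon^{\nu},\delta^{\nu}) \rightarrow (0,0)$ as $\nu \to \infty$, then $P^{\nu} \rightarrow C$ in the sense of Painlevé-Kuratowski.
   Context: $\|\cdot\|$ is the Euclidean norm, $B_r(c)$ is the closed Euclidean ball of radius $r$ centered at $c$, and $0^+C$ is the recession cone of $C$. A closed convex set is line-free if its recession cone $K$ is pointed, i.e. $K \cap (-K) = \{0\}$. A polyhedron is a set $\operatorname{conv} V + \operatorname{cone} D$ with $V, D$ finite; $\operatorname{vert} P$ denotes its set of vertices (extreme points). For nonempty $C_1,C_2\subseteq\mathbb{R}^n$ the excess of $C_1$ over $C_2$ is $e[C_1,C_2] = \sup_{c_1 \in C_1} \inf_{c_2 \in C_2} \|c_1-c_2\|$, and the Hausdorff distance is $d_{\mathsf H}(C_1,C_2) = \max\{e[C_1,C_2], e[C_2,C_1]\}$. For nonempty closed convex cones $K_1,K_2$ the truncated Hausdorff distance is $\bar d_{\mathsf H}(K_1,K_2) = d_{\mathsf H}(K_1\cap B_1(0), K_2 \cap B_1(0))$. Given a nonempty closed convex line-free set $C\subseteq\mathbb{R}^n$ and $\varepsilon,\delta\ge 0$, a line-free polyhedron $P$ is called an $(\varepsilon,\delta)$-approximation of $C$ if (i) $e[\operatorname{vert} P, C] \leq \varepsilon$, (ii) $\bar d_{\mathsf H}(0^+P, 0^+C) \leq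 \delta$, and (iii) $P \supseteq C$. A sequence $\{C^{\nu}\}_{\nu\in\mathbb{N}}$ of subsets of $\mathbb{R}^n$ converges to $C \subseteq \mathbb{R}^n$ in the sense of Painlevé-Kuratowski if $C$ equals both the set of $x\in\mathbb{R}^n$ such that for every open neighbourhood $U$ of $x$, $U\cap C^\nu\neq\emptyset$ for all large enough $\nu$, and the set of $x\in\mathbb{R}^n$ such that for every open neighbourhood $U$ of $x$, $U\cap C^\nu\neq\emptyset$ for infinitely many $\nu$. *)

theory Defs
  imports "HOL-Analysis.Analysis"
begin

definition recession_cone :: "'a::real_vector set \<Rightarrow> 'a set" where
  "recession_cone C = {d. \<forall>x\<in>C. \<forall>t\<ge>0. x + t *\<^sub>R d \<in> C}"

(* Only meant for nonempty closed convex sets; recession_cone {} = UNIV. *)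
definition line_free :: "'a::real_vector set \<Rightarrow> bool" where
  "line_free C \<longleftrightarrow> recession_cone C \<inter> uminus ` recession_cone C = {0}"

(* conv V + cone D.  The library predicate polyhedron is instead a finite intersection of
   half-spaces.  A convex_cone is nonempty, hence contains 0, so D = {} gives the cone {0}. *)
definition vd_polyhedron :: "'a::real_vector set \<Rightarrow> bool" where
  "vd_polyhedron P \<longleftrightarrow>
     (\<exists>V D. finite V \<and> finite D \<and>
        P = {v + d | v d. v \<in> convex hull V \<and> d \<in> convex_cone hull D})"

definition vert :: "'a::real_vector set \<Rightarrow> 'a set" where
  "vert P = {x. x extreme_point_of P}"

(* Extended-real valued, since the excess of an unbounded set may be infinite.
   Only meant for nonempty arguments. *)
definition excess :: "'a::real_normed_vector set \<Rightarrow> 'a set \<Rightarrow> ereal" where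
  "excess C1 C2 = (SUP c1\<in>C1. INF c2\<in>C2. ereal (norm (c1 - c2)))"

definition hausdorff_dist :: "'a::real_normed_vector set \<Rightarrow> 'a set \<Rightarrow> ereal" where
  "hausdorff_dist C1 C2 = max (excess C1 C2) (excess C2 C1)"

definition trunc_hausdorff_dist :: "'a::real_normed_vector set \<Rightarrow> 'a set \<Rightarrow> ereal" where
  "trunc_hausdorff_dist K1 K2 = hausdorff_dist (K1 \<inter> cball 0 1) (K2 \<inter> cball 0 1)"

(* The standing requirements on C (nonempty, closed, convex, line-free) are left to the
   statements that use this notion. *)
definition eps_delta_approximation ::
    "real \<Rightarrow> real \<Rightarrow> 'a::real_normed_vector set \<Rightarrow> 'a set \<Rightarrow> bool" where
  "eps_delta_approximation \<epsilon> \<delta> C P \<longleftrightarrow>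
     0 \<le> \<epsilon> \<and> 0 \<le> \<delta> \<and> vd_polyhedron P \<and> line_free P \<and>
     excess (vert P) C \<le> ereal \<epsilon> \<and>
     trunc_hausdorff_dist (recession_cone P) (recession_cone C) \<le> ereal \<delta> \<and>
     C \<subseteq> P"

definition PK_inner_limit :: "(nat \<Rightarrow> 'a::topological_space set) \<Rightarrow> 'a set" where
  "PK_inner_limit S =
     {x. \<forall>U. open U \<and> x \<in> U \<longrightarrow> (\<forall>\<^sub>F \<nu> in sequentially. U \<inter> S \<nu> \<noteq> {})}"

definition PK_outer_limit :: "(nat \<Rightarrow> 'a::topological_space set) \<Rightarrow> 'a set" where
  "PK_outer_limit S =
     {x. \<forall>U. open U \<and> x \<in> U \<longrightarrow> (\<exists>\<^sub>\<infinity>\<nu>. U \<inter> S \<nu> \<noteq> {})}"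

(* Painleve-Kuratowski convergence *)
definition PK_converges :: "(nat \<Rightarrow> 'a::topological_space set) \<Rightarrow> 'a set \<Rightarrow> bool" where
  "PK_converges S C \<longleftrightarrow> C = PK_inner_limit S \<and> C = PK_outer_limit S"

end

theory Submission
  imports Defs
begin

text \<open>Only \<open>PK_outer_limit P \<subseteq> C\<close> needs work. A limit point \<open>x\<close> is approached by
  \<open>v\<^sub>k + d\<^sub>k\<close> with \<open>v\<^sub>k\<close> in the convex hull of the vertices and \<open>d\<^sub>k\<close> a recession direction
  of a polyhedron; these are close to some \<open>c\<^sub>k \<in> C\<close> and, up to a factor \<open>\<parallel>d\<^sub>k\<parallel>\<close>, to
  recession directions of \<open>C\<close>. If \<open>d\<^sub>k\<close> were unbounded, a limit direction \<open>u\<close> of \<open>d\<^sub>k / \<parallel>d\<^sub>k\<parallel>\<close>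
  would satisfy \<open>u, -u \<in> 0\<^sup>+C\<close>, as \<open>c\<^sub>k / \<parallel>d\<^sub>k\<parallel>\<close> tends to \<open>-u\<close>; this is excluded
  because \<open>C\<close> is line-free. So \<open>d\<^sub>k\<close> is bounded and \<open>x\<close> is a limit of points of \<open>C\<close>.\<close>

section \<open>Recession cones of closed convex sets\<close>

lemma recession_cone_scaleR:
  assumes "d \<in> recession_cone C" "0 \<le> s"
  shows "s *\<^sub>R d \<in> recession_cone C"
  unfolding recession_cone_def
proof (intro CollectI ballI allI impI)
  fix x t assume "x \<in> C" "0 \<le> (t::real)"
  then have "x + (t * s) *\<^sub>R d \<in> C"
    using assms by (simp add: recession_cone_def)
  then show "x + t *\<^sub>R s *\<^sub>R d \<in> C" by simp
qed

lemma zero_in_recession_cone: "0 \<in> recession_cone C"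
  by (simp add: recession_cone_def)

lemma add_recession_cone:
  assumes "x \<in> C" "d \<in> recession_cone C"
  shows "x + d \<in> C"
proof -
  have "\<forall>t\<ge>0. x + t *\<^sub>R d \<in> C"
    using assms by (simp add: recession_cone_def)
  then show ?thesis by (metis scaleR_one zero_le_one)
qed

lemma closed_recession_cone:
  fixes C :: "'a::real_normed_vector set"
  assumes "closed C"
  shows "closed (recession_cone C)"
proof -
  have "recession_cone C = (\<Inter>x\<in>C. \<Inter>t\<in>{0..}. (\<lambda>d. x + t *\<^sub>R d) -` C)"
    by (auto simp: recession_cone_def)
  moreover have "closed ((\<lambda>d. x + t *\<^sub>R d) -` C)" for x and t :: real
    by (intro closed_vimage assms continuous_intros)
  ultimately show ?thesis
    by (simp add: closed_INT)
qed

text \<open>Once \<open>\<tau> k > t\<close>, moving from \<open>x\<close> the fraction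
  \<open>t / \<tau> k\<close> of the way towards \<open>c k\<close> stays in \<open>C\<close> by
  convexity. These points tend to \<open>x + t *\<^sub>R d\<close>, which closedness keeps in
  \<open>C\<close>.\<close>

lemma asymptotic_direction_in_recession_cone:
  fixes C :: "'a::real_normed_vector set"
  assumes "closed C" "convex C" and c: "\<And>k::nat. c k \<in> C"
    and \<tau>: "filterlim \<tau> at_top sequentially"
    and lim: "(\<lambda>k. c k /\<^sub>R \<tau> k) \<longlonglongrightarrow> d"
  shows "d \<in> recession_cone C"
  unfolding recession_cone_def
proof (intro CollectI ballI allI impI)
  fix x t assume x: "x \<in> C" and t: "0 \<le> (t::real)"
  have inv: "(\<lambda>k. inverse (\<tau> k)) \<longlonglongrightarrow> 0"
    using \<tau> by (rule tendsto_inverse_0_at_top)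
  have "(\<lambda>k. (1 - t * inverse (\<tau> k)) *\<^sub>R x + t *\<^sub>R (c k /\<^sub>R \<tau> k)) \<longlonglongrightarrow> (1 - t * 0) *\<^sub>R x + t *\<^sub>R d"
    by (intro tendsto_intros inv lim)
  moreover have "\<forall>\<^sub>F k in sequentially.
      (1 - t * inverse (\<tau> k)) *\<^sub>R x + t *\<^sub>R (c k /\<^sub>R \<tau> k) \<in> C"
    using filterlim_at_top_dense[THEN iffD1, OF \<tau>, rule_format, of t]
  proof eventually_elim
    case (elim k)
    have "(1 - t * inverse (\<tau> k)) *\<^sub>R x + (t * inverse (\<tau> k)) *\<^sub>R c k \<in> C"
      using \<open>convex C\<close> x c elim t
      by (intro convexD) (auto simp: field_simps)
    then show ?case by simp
  qed
  ultimately show "x + t *\<^sub>R d \<in> C"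
    using Lim_in_closed_set[OF \<open>closed C\<close>] by fastforce
qed

section \<open>From excess and Hausdorff bounds to nearby points\<close>

text \<open>The infimum is attained because \<open>B\<close> is closed and nonempty in a Heine-Borel
  space, so the bound \<open>\<epsilon>\<close> is met without slack.\<close>

lemma excess_le_witness:
  fixes B :: "'a::{real_normed_vector, heine_borel} set"
  assumes "excess A B \<le> ereal \<epsilon>" "a \<in> A" "closed B" "B \<noteq> {}"
  obtains b where "b \<in> B" "norm (a - b) \<le> \<epsilon>"
proof -
  obtain b where b: "b \<in> B" "infdist a B = dist a b"
    using infdist_attains_inf[OF assms(3,4)] by blast
  have "ereal (infdist a B) \<le> (INF c\<in>B. ereal (norm (a - c)))"
    by (intro INF_greatest) (auto simp: dist_norm[symmetric] intro: infdist_le)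
  also have "\<dots> \<le> ereal \<epsilon>"
    using assms(1,2) unfolding excess_def by (simp add: SUP_le_iff)
  finally show thesis
    using that b by (simp add: dist_norm)
qed

text \<open>The truncated distance speaks about the unit ball only. Normalising \<open>d\<close> and
  scaling the witness back by \<open>norm d\<close> makes the error proportional to
  \<open>norm d\<close>.\<close>

lemma trunc_hausdorff_dist_witness:
  fixes C :: "'a::{real_normed_vector, heine_borel} set"
  assumes "trunc_hausdorff_dist (recession_cone P) (recession_cone C) \<le> ereal \<delta>"
    and "closed C" "d \<in> recession_cone P"
  obtains e where "e \<in> recession_cone C" "norm (d - e) \<le> \<delta> * norm d"
proof (cases "d = 0")
  case True
  then show thesis using that[of 0] by (simp add: zero_in_recession_cone)
next
  case False
  define u where "u = d /\<^sub>R norm d"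
  have "u \<in> recession_cone P \<inter> cball 0 1"
    using False assms(3) by (simp add: u_def recession_cone_scaleR)
  moreover have "excess (recession_cone P \<inter> cball 0 1) (recession_cone C \<inter> cball 0 1) \<le> ereal \<delta>"
    using assms(1) by (simp add: trunc_hausdorff_dist_def hausdorff_dist_def)
  moreover have "closed (recession_cone C \<inter> cball 0 1)"
    using closed_recession_cone[OF assms(2)] by blast
  moreover have "recession_cone C \<inter> cball 0 1 \<noteq> {}"
    using zero_in_recession_cone[of C] by fastforce
  ultimately obtain e where e: "e \<in> recession_cone C" "norm (u - e) \<le> \<delta>"
    using excess_le_witness by (metis IntD1)
  have "norm (d - norm d *\<^sub>R e) = norm (norm d *\<^sub>R (u - e))"
    using False by (simp add: u_def scaleR_diff_right)
  also have "\<dots> = norm d * norm (u - e)" by simp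
  also have "\<dots> \<le> \<delta> * norm d" using mult_left_mono[OF e(2), of "norm d"] by (simp add: mult.commute)
  finally show thesis
    using that e(1) recession_cone_scaleR norm_ge_zero by blast
qed

text \<open>The sum of \<open>C\<close> and the ball of radius \<open>\<epsilon>\<close> is convex,
  so it contains the hull of \<open>A\<close> as soon as it contains \<open>A\<close>.\<close>

lemma convex_hull_excess_witness:
  fixes C :: "'a::euclidean_space set"
  assumes "excess A C \<le> ereal \<epsilon>" "closed C" "convex C" "C \<noteq> {}" "v \<in> convex hull A"
  obtains c where "c \<in> C" "norm (v - c) \<le> \<epsilon>"
proof -
  let ?N = "\<Union>x\<in>C. \<Union>y\<in>cball 0 \<epsilon>. {x + y}"
  have "A \<subseteq> ?N"
  proof
    fix a assume "a \<in> A"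
    then obtain c where "c \<in> C" "norm (a - c) \<le> \<epsilon>"
      using excess_le_witness assms by metis
    moreover from this have "a - c \<in> cball 0 \<epsilon>" "a = c + (a - c)" by simp_all
    ultimately show "a \<in> ?N" by blast
  qed
  then have "convex hull A \<subseteq> ?N"
    by (intro hull_minimal convex_sums assms) auto
  then show thesis using that assms(5) by fastforce
qed

section \<open>Line-free polyhedra are generated by their vertices and recession directions\<close>

text \<open>If \<open>v\<close> lies in the relative interior of a segment \<open>[a, b]\<close>, write both endpoints in terms
  of \<open>v\<close>, \<open>W\<close> and \<open>K\<close> and solve for \<open>v\<close>; pointedness rules out that \<open>W\<close> does not occur.\<close>

lemma redundant_generator:
  fixes K :: "'a::real_vector set"
  assumes K: "convex_cone K" "K \<inter> uminus ` K \<subseteq> {0}"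
    and P: "P = {x + d | x d. x \<in> convex hull (insert v W) \<and> d \<in> K}"
    and v: "\<not> v extreme_point_of P"
  shows "v \<in> {x + d | x d. x \<in> convex hull W \<and> d \<in> K}"
proof -
  define Q where "Q = {x + d | x d. x \<in> convex hull W \<and> d \<in> K}"
  have K0: "0 \<in> K" using K(1) by (rule convex_cone_contains_0)
  have Kadd: "x + y \<in> K" if "x \<in> K" "y \<in> K" for x y
    using K(1) that by (simp add: convex_cone_add)
  have Ks: "s *\<^sub>R x \<in> K" if "x \<in> K" "0 \<le> s" for x s
    using K(1) that by (simp add: convex_cone_scaleR)
  have Qadd: "q + k \<in> Q" if "q \<in> Q" "k \<in> K" for q k
    using that Kadd by (fastforce simp: Q_def add.assoc)
  have "convex Q"
  proof -
    have "Q = (\<Union>x\<in>convex hull W. \<Union>y\<in>K. {x + y})" unfolding Q_def by blast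
    then show ?thesis using K(1) by (simp add: convex_sums convex_cone_def)
  qed
  have "v \<in> P"
    unfolding P using hull_inc[of v "insert v W"] K0 by force
  then obtain a b t where ab: "a \<in> P" "b \<in> P" "a \<noteq> b" and t: "0 < t" "t < 1"
    and vab: "v = (1 - t) *\<^sub>R a + t *\<^sub>R b"
    using v by (auto simp: extreme_point_of_def in_segment)
  \<comment> \<open>Each point of \<open>P\<close> lies in \<open>v + K\<close> or on a ray from
    \<open>v\<close> through a point of \<open>Q\<close>. The weight \<open>\<beta>\<close> on
    \<open>W\<close> decides which: if it is positive, the cone part is divided by
    \<open>\<beta>\<close> and absorbed into \<open>Q\<close>.\<close>
  have repr: "(\<exists>k\<in>K. y = v + k) \<or> (\<exists>\<beta> q. 0 < \<beta> \<and> q \<in> Q \<and> y = v + \<beta> *\<^sub>R (q - v))"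
    if y: "y \<in> P" for y
  proof -
    obtain x k where xk: "y = x + k" "x \<in> convex hull insert v W" "k \<in> K"
      using y P by blast
    show ?thesis
    proof (cases "W = {}")
      case True
      then show ?thesis using xk by auto
    next
      case False
      then obtain \<alpha> \<beta> w where w: "0 \<le> \<beta>" "\<alpha> + \<beta> = 1" "w \<in> convex hull W"
          "x = \<alpha> *\<^sub>R v + \<beta> *\<^sub>R w"
        using xk(2) by (auto simp: convex_hull_insert)
      have \<alpha>: "\<alpha> = 1 - \<beta>" using w(2) by simp
      show ?thesis
      proof (cases "\<beta> = 0")
        case True
        then show ?thesis using xk w \<alpha> by auto
      next
        case False
        have "y = v + \<beta> *\<^sub>R (w + k /\<^sub>R \<beta> - v)"
          using False by (simp add: xk(1) w(4) \<alpha> algebra_simps)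
        moreover have "k /\<^sub>R \<beta> \<in> K" using w(1) xk(3) Ks by simp
        then have "w + k /\<^sub>R \<beta> \<in> Q" using w(3) unfolding Q_def by blast
        moreover have "0 < \<beta>" using False w(1) by simp
        ultimately show ?thesis by blast
      qed
    qed
  qed
  \<comment> \<open>As \<open>r > 0\<close>, the relation can be solved for \<open>v\<close>, giving
    \<open>q + (s / r) *\<^sub>R k\<close>, and \<open>Q\<close> is stable under adding
    \<open>K\<close>.\<close>
  have mixed: "v \<in> Q"
    if "s *\<^sub>R k + r *\<^sub>R (q - v) = 0" "0 \<le> s" "0 < r" "k \<in> K" "q \<in> Q" for s r k q
  proof -
    have "r *\<^sub>R v = r *\<^sub>R (q + (s / r) *\<^sub>R k)"
      using that(1,3) by (simp add: algebra_simps)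
    then have eq: "v = q + (s / r) *\<^sub>R k" using that(3) by simp
    have "(s / r) *\<^sub>R k \<in> K" using Ks that(2-4) by simp
    then have "q + (s / r) *\<^sub>R k \<in> Q" by (rule Qadd[OF that(5)])
    then show ?thesis using eq by simp
  qed
  have "v \<in> Q"
  proof -
    consider k l where "k \<in> K" "l \<in> K" "a = v + k" "b = v + l"
      | k r q where "k \<in> K" "0 < r" "q \<in> Q" "a = v + k" "b = v + r *\<^sub>R (q - v)"
      | k r q where "k \<in> K" "0 < r" "q \<in> Q" "b = v + k" "a = v + r *\<^sub>R (q - v)"
      | r q s p where "0 < r" "q \<in> Q" "0 < s" "p \<in> Q"
          "a = v + r *\<^sub>R (q - v)" "b = v + s *\<^sub>R (p - v)"
      using repr[OF ab(1)] repr[OF ab(2)] by metis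
    then show "v \<in> Q"
    proof cases
      \<comment> \<open>Both endpoints lie in \<open>v + K\<close>: pointedness collapses them to
        \<open>v\<close>, contradicting \<open>a \<noteq> b\<close>.\<close>
      case 1
      have "(1 - t) *\<^sub>R k + t *\<^sub>R l = 0"
        using vab 1(3,4) by (simp add: algebra_simps)
      then have eq: "(1 - t) *\<^sub>R k = - (t *\<^sub>R l)" by (simp add: eq_neg_iff_add_eq_0)
      have "(1 - t) *\<^sub>R k \<in> K" "t *\<^sub>R l \<in> K" using Ks 1(1,2) t by simp_all
      then have "(1 - t) *\<^sub>R k \<in> K \<inter> uminus ` K" using eq by auto
      then have "(1 - t) *\<^sub>R k = 0" using K(2) by blast
      then have "k = 0" "l = 0" using eq t by simp_all
      then show "v \<in> Q" using 1 ab(3) by simp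
    next
      case 2
      have "(1 - t) *\<^sub>R k + (t * r) *\<^sub>R (q - v) = 0"
        using vab 2(4,5) by (simp add: algebra_simps)
      then show "v \<in> Q" using mixed 2 t by simp
    next
      case 3
      have "t *\<^sub>R k + ((1 - t) * r) *\<^sub>R (q - v) = 0"
        using vab 3(4,5) by (simp add: algebra_simps)
      then show "v \<in> Q" using mixed 3 t by simp
    next
      case 4
      \<comment> \<open>The total weight on \<open>q\<close> and \<open>p\<close> after cancelling
        \<open>v\<close>; dividing by it exhibits \<open>v\<close> as their convex
        combination.\<close>
      define g where "g = (1 - t) * r + t * s"
      have g: "0 < g" using 4 t by (simp add: g_def add_pos_pos)
      have "g *\<^sub>R v = ((1 - t) * r) *\<^sub>R q + (t * s) *\<^sub>R p"
        using vab 4(5,6) by (simp add: g_def algebra_simps)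
      then have "v = inverse g *\<^sub>R (((1 - t) * r) *\<^sub>R q + (t * s) *\<^sub>R p)"
        using g by (metis less_irrefl scaleR_scaleR left_inverse scaleR_one)
      then have "v = ((1 - t) * r / g) *\<^sub>R q + (t * s / g) *\<^sub>R p"
        by (simp add: scaleR_add_right divide_inverse mult.commute)
      moreover have "((1 - t) * r / g) *\<^sub>R q + (t * s / g) *\<^sub>R p \<in> Q"
        using 4 t g by (intro convexD[OF \<open>convex Q\<close>])
          (auto simp: g_def add_divide_distrib[symmetric])
      ultimately show "v \<in> Q" by simp
    qed
  qed
  then show ?thesis by (simp only: Q_def)
qed

text \<open>A generator that is not a vertex is redundant. Dropping such generators one at a time
  leaves \<open>P\<close> unchanged, and finiteness of \<open>V\<close> ends this with vertices
  only.\<close>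

lemma generators_reducible_to_vertices:
  fixes K :: "'a::real_vector set"
  assumes "finite V" and K: "convex_cone K" "K \<inter> uminus ` K \<subseteq> {0}"
    and "P = {x + d | x d. x \<in> convex hull V \<and> d \<in> K}"
  shows "P \<subseteq> {x + d | x d. x \<in> convex hull (vert P) \<and> d \<in> K}"
  using assms(1,4)
proof (induction V rule: finite_psubset_induct)
  case (psubset V)
  show ?case
  proof (cases "V \<subseteq> vert P")
    case True
    then show ?thesis using psubset.prems hull_mono[OF True, of convex] by blast
  next
    case False
    then obtain v where v: "v \<in> V" "\<not> v extreme_point_of P"
      by (auto simp: vert_def)
    let ?W = "V - {v}" and ?Q = "{x + d | x d. x \<in> convex hull (V - {v}) \<and> d \<in> K}"
    have V: "V = insert v ?W" using v(1) by blast
    have vQ: "v \<in> ?Q"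
      using psubset.prems redundant_generator[OF K _ v(2), of ?W] V by simp
    \<comment> \<open>What remains is \<open>P = ?Q\<close>, so that the induction hypothesis
      applies to the smaller generating set with the same \<open>P\<close> and hence the same
      vertices.\<close>
    have W: "w \<in> ?Q" if "w \<in> ?W" for w
      using hull_inc[OF that, of convex] convex_cone_contains_0[OF K(1)] by force
    have "?Q = (\<Union>x\<in>convex hull ?W. \<Union>y\<in>K. {x + y})" by blast
    then have "convex ?Q" using K(1) by (simp add: convex_sums convex_cone_def)
    moreover have "V \<subseteq> ?Q" using vQ W by blast
    ultimately have "convex hull V \<subseteq> ?Q" by (intro hull_minimal)
    moreover have "q + k \<in> ?Q" if "q \<in> ?Q" "k \<in> K" for q k
      using that convex_cone_add[OF K(1)] by (fastforce simp: add.assoc)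
    ultimately have "P \<subseteq> ?Q" using psubset.prems by blast
    moreover have "?Q \<subseteq> P"
      using psubset.prems hull_mono[of ?W V convex] by blast
    ultimately show ?thesis
      using psubset.IH[of ?W] v(1) by blast
  qed
qed

text \<open>The cone generated by \<open>D\<close> lies in the recession cone of \<open>P\<close>,
  so line-freeness makes it pointed and the generators can be reduced to vertices.\<close>

lemma vd_polyhedron_vertex_decomposition:
  assumes "vd_polyhedron P" "line_free P" "x \<in> P"
  obtains v d where "v \<in> convex hull (vert P)" "d \<in> recession_cone P" "x = v + d"
proof -
  obtain V D where V: "finite V"
    and P: "P = {v + d | v d. v \<in> convex hull V \<and> d \<in> convex_cone hull D}"
    using assms(1) by (auto simp: vd_polyhedron_def)
  let ?K = "convex_cone hull D"
  have K: "convex_cone ?K" by (rule convex_cone_convex_cone_hull)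
  have rec: "?K \<subseteq> recession_cone P"
    unfolding recession_cone_def
  proof (intro subsetI CollectI ballI allI impI)
    fix k x t assume "k \<in> ?K" "x \<in> P" "0 \<le> (t::real)"
    then obtain v d where "v \<in> convex hull V" "d \<in> ?K" "x = v + d" "t *\<^sub>R k \<in> ?K"
      using P convex_cone_hull_mul by blast
    then show "x + t *\<^sub>R k \<in> P"
      using convex_cone_add[OF K] by (fastforce simp: P add.assoc)
  qed
  then have "?K \<inter> uminus ` ?K \<subseteq> {0}"
    using assms(2) unfolding line_free_def by blast
  then have "P \<subseteq> {x + d | x d. x \<in> convex hull (vert P) \<and> d \<in> ?K}"
    by (rule generators_reducible_to_vertices[OF V K _ P])
  then show thesis using that assms(3) rec by blast
qed

section \<open>Approximate decompositions and boundedness of their recession parts\<close>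

lemma eps_delta_approximation_witness:
  fixes C :: "'a::euclidean_space set"
  assumes "C \<noteq> {}" "closed C" "convex C"
    and "eps_delta_approximation \<epsilon> \<delta> C P" "x \<in> P"
  obtains c d e where "c \<in> C" "e \<in> recession_cone C"
    "norm (x - d - c) \<le> \<epsilon>" "norm (d - e) \<le> \<delta> * norm d"
proof -
  obtain v d where vd: "v \<in> convex hull (vert P)" "d \<in> recession_cone P" "x = v + d"
    using vd_polyhedron_vertex_decomposition assms(4,5)
    unfolding eps_delta_approximation_def by metis
  obtain c where "c \<in> C" "norm (v - c) \<le> \<epsilon>"
    using convex_hull_excess_witness[OF _ assms(2,3,1) vd(1)] assms(4)
    unfolding eps_delta_approximation_def by metis
  moreover obtain e where "e \<in> recession_cone C" "norm (d - e) \<le> \<delta> * norm d"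
    using trunc_hausdorff_dist_witness[OF _ assms(2) vd(2)] assms(4)
    unfolding eps_delta_approximation_def by metis
  ultimately show thesis using that[of c e d] vd(3) by simp
qed

lemma line_free_eventually_bounded:
  fixes C :: "'a::euclidean_space set"
  assumes "closed C" "convex C" "line_free C"
    and c: "\<And>k::nat. c k \<in> C" and e: "\<And>k. e k \<in> recession_cone C"
    and x: "x \<longlonglongrightarrow> l" and cd: "(\<lambda>k. x k - d k - c k) \<longlonglongrightarrow> 0"
    and de: "\<And>k. norm (d k - e k) \<le> \<delta> k * norm (d k)" and \<delta>: "\<delta> \<longlonglongrightarrow> 0"
  shows "\<exists>B. \<forall>\<^sub>F k in sequentially. norm (d k) \<le> B"
proof (rule ccontr)
  assume "\<not> ?thesis"
  then have "\<exists>k\<ge>m. real m < norm (d k)" for m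
    by (auto simp: eventually_sequentially not_le)
  \<comment> \<open>\<open>s\<close> need not be monotone; \<open>m \<le> s m\<close> is enough to
    push its values to infinity.\<close>
  then obtain s where s: "\<And>m. m \<le> s m" "\<And>m. real m < norm (d (s m))"
    by metis
  let ?u = "\<lambda>m. d (s m) /\<^sub>R norm (d (s m))"
  have nz: "d (s m) \<noteq> 0" for m
    using s(2)[of m] by auto
  have "\<forall>m. ?u m \<in> sphere 0 1" using nz by simp
  then obtain u r where u: "u \<in> sphere 0 1" and r: "strict_mono r" "(?u \<circ> r) \<longlonglongrightarrow> u"
    by (rule seq_compactE[OF compact_imp_seq_compact[OF compact_sphere]])
  \<comment> \<open>Combines \<open>s\<close> with the subsequence from compactness of the sphere;
    \<open>m \<le> r m\<close> preserves both bounds on \<open>s\<close>.\<close>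
  define p where "p m = s (r m)" for m
  have pm: "m \<le> p m" "real m < norm (d (p m))" for m
    using s(1)[of "r m"] s(2)[of "r m"] seq_suble[OF r(1), of m] by (auto simp: p_def)
  have p: "filterlim p at_top sequentially"
    by (rule filterlim_at_top_mono[OF filterlim_ident]) (simp add: pm(1))
  have \<tau>: "filterlim (\<lambda>m. norm (d (p m))) at_top sequentially"
    by (rule filterlim_at_top_mono[OF filterlim_real_sequentially])
      (simp add: less_imp_le pm(2))
  have inv: "(\<lambda>m. inverse (norm (d (p m)))) \<longlonglongrightarrow> 0"
    using \<tau> by (rule tendsto_inverse_0_at_top)
  have nzp: "d (p m) \<noteq> 0" for m using nz by (simp add: p_def)
  have up: "(\<lambda>m. d (p m) /\<^sub>R norm (d (p m))) \<longlonglongrightarrow> u"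
    using r(2) by (simp add: o_def p_def)
  have near: "norm ((d (p m) - e (p m)) /\<^sub>R norm (d (p m))) \<le> \<delta> (p m)" for m
  proof -
    have "norm ((d (p m) - e (p m)) /\<^sub>R norm (d (p m)))
        = norm (d (p m) - e (p m)) / norm (d (p m))"
      by (simp add: divide_inverse mult.commute)
    also have "\<dots> \<le> \<delta> (p m)"
      using de[of "p m"] nzp[of m] by (simp add: pos_divide_le_eq)
    finally show ?thesis .
  qed
  have \<delta>p: "(\<lambda>m. \<delta> (p m)) \<longlonglongrightarrow> 0"
    using \<delta> p by (rule filterlim_compose)
  have "(\<lambda>m. (d (p m) - e (p m)) /\<^sub>R norm (d (p m))) \<longlonglongrightarrow> 0"
    by (rule Lim_null_comparison[OF always_eventually \<delta>p]) (use near in blast)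
  \<comment> \<open>The error bound is relative to \<open>norm (d k)\<close>, so after normalisation
    \<open>e\<close> has the same limit direction as \<open>d\<close>.\<close>
  from tendsto_diff[OF up this] have "(\<lambda>m. e (p m) /\<^sub>R norm (d (p m))) \<longlonglongrightarrow> u"
    by (simp add: scaleR_diff_right)
  then have u_rec: "u \<in> recession_cone C"
    by (rule closed_sequentially[OF closed_recession_cone[OF assms(1)], rotated])
      (simp add: recession_cone_scaleR e)
  \<comment> \<open>Writes \<open>c\<close> as \<open>x - (x - d - c) - d\<close>; divided by the
    growing norm, the convergent terms vanish and only \<open>- u\<close> survives.\<close>
  have "(\<lambda>m. inverse (norm (d (p m))) *\<^sub>R (x (p m) - (x (p m) - d (p m) - c (p m)))
      - d (p m) /\<^sub>R norm (d (p m))) \<longlonglongrightarrow> 0 *\<^sub>R (l - 0) - u"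
    by (intro tendsto_intros inv up filterlim_compose[OF x p] filterlim_compose[OF cd p])
  then have "(\<lambda>m. c (p m) /\<^sub>R norm (d (p m))) \<longlonglongrightarrow> - u"
    by (simp add: scaleR_add_right)
  then have "- u \<in> recession_cone C"
    by (rule asymptotic_direction_in_recession_cone[OF assms(1,2) c \<tau>])
  then have "u \<in> recession_cone C \<inter> uminus ` recession_cone C"
    using u_rec by (metis IntI imageI minus_minus)
  then have "u = 0" using assms(3) unfolding line_free_def by blast
  then show False using u by simp
qed

section \<open>Painleve-Kuratowski limits\<close>

text \<open>Balls of radius \<open>1 / (k + 1)\<close> meet \<open>S n\<close> for some
  \<open>n \<ge> k\<close>. The indices \<open>r\<close> may repeat, but tending to infinity
  suffices for composing limits with them.\<close>

lemma PK_outer_limit_sequence: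
  fixes x :: "'a::metric_space"
  assumes "x \<in> PK_outer_limit S"
  obtains r y where "filterlim r at_top sequentially" "\<And>k. y k \<in> S (r k)" "y \<longlonglongrightarrow> x"
proof -
  have "\<exists>n\<ge>k. \<exists>z\<in>S n. dist z x < inverse (real (Suc k))" for k
  proof -
    have "\<exists>\<^sub>\<infinity>n. ball x (inverse (real (Suc k))) \<inter> S n \<noteq> {}"
      using assms by (simp add: PK_outer_limit_def)
    then obtain n z where "n \<ge> k" "z \<in> S n" "dist x z < inverse (real (Suc k))"
      unfolding INFM_nat_le by fastforce
    then show ?thesis by (metis dist_commute)
  qed
  then obtain r y where ry: "\<And>k. k \<le> r k" "\<And>k. y k \<in> S (r k)"
      "\<And>k. dist (y k) x < inverse (real (Suc k))"
    by metis
  have "filterlim r at_top sequentially"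
    by (rule filterlim_at_top_mono[OF filterlim_ident]) (simp add: ry(1))
  moreover have "(\<lambda>k. dist (y k) x) \<longlonglongrightarrow> 0"
    by (rule tendsto_sandwich[OF _ _ tendsto_const LIMSEQ_inverse_real_of_nat])
      (auto simp: less_imp_le ry(3) simp del: of_nat_Suc)
  ultimately show thesis using that ry(2) tendsto_dist_iff by blast
qed

lemma PK_outer_limit_subset:
  fixes C :: "'a::euclidean_space set"
  assumes C: "C \<noteq> {}" "closed C" "convex C" "line_free C"
    and P: "\<And>\<nu>. eps_delta_approximation (\<epsilon> \<nu>) (\<delta> \<nu>) C (P \<nu>)"
    and \<epsilon>: "\<epsilon> \<longlonglongrightarrow> 0" and \<delta>: "\<delta> \<longlonglongrightarrow> 0"
  shows "PK_outer_limit P \<subseteq> C"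
proof
  fix l assume "l \<in> PK_outer_limit P"
  then obtain r x where r: "filterlim r at_top sequentially"
    and xP: "\<And>k. x k \<in> P (r k)" and x: "x \<longlonglongrightarrow> l"
    using PK_outer_limit_sequence by blast
  have "\<exists>c d e. c \<in> C \<and> e \<in> recession_cone C \<and>
      norm (x k - d - c) \<le> \<epsilon> (r k) \<and> norm (d - e) \<le> \<delta> (r k) * norm d" for k
    using eps_delta_approximation_witness[OF C(1-3) P xP] by metis
  then obtain c d e where c: "\<And>k. c k \<in> C" and e: "\<And>k. e k \<in> recession_cone C"
    and cd: "\<And>k. norm (x k - d k - c k) \<le> \<epsilon> (r k)"
    and de: "\<And>k. norm (d k - e k) \<le> \<delta> (r k) * norm (d k)"
    by metis
  have \<epsilon>r: "(\<lambda>k. \<epsilon> (r k)) \<longlonglongrightarrow> 0" and \<delta>r: "(\<lambda>k. \<delta> (r k)) \<longlonglongrightarrow> 0"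
    using filterlim_compose[OF \<epsilon> r] filterlim_compose[OF \<delta> r] .
  have cd0: "(\<lambda>k. x k - d k - c k) \<longlonglongrightarrow> 0"
    by (rule Lim_null_comparison[OF always_eventually \<epsilon>r]) (use cd in blast)
  obtain B where B: "\<forall>\<^sub>F k in sequentially. norm (d k) \<le> B"
    using line_free_eventually_bounded[OF C(2-4) c e x cd0 de \<delta>r] by blast
  \<comment> \<open>The bound on \<open>d\<close> turns the relative error
    \<open>\<delta> (r k) * norm (d k)\<close> into an absolute one that vanishes.\<close>
  have "(\<lambda>k. \<delta> (r k) * B) \<longlonglongrightarrow> 0"
    using tendsto_mult_right[OF \<delta>r, of B] by simp
  moreover have "\<forall>\<^sub>F k in sequentially. norm (d k - e k) \<le> \<delta> (r k) * B"
    using B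
  proof eventually_elim
    case (elim k)
    have "0 \<le> \<delta> (r k)" using P[of "r k"] by (simp add: eps_delta_approximation_def)
    then show ?case using de[of k] mult_left_mono[OF elim] by (meson order_trans)
  qed
  ultimately have de0: "(\<lambda>k. d k - e k) \<longlonglongrightarrow> 0"
    by (rule Lim_null_comparison[rotated])
  \<comment> \<open>Here \<open>c + e\<close> equals \<open>x - (x - d - c) - (d - e)\<close>, and
    it lies in \<open>C\<close> because \<open>e\<close> is a recession direction.\<close>
  have "(\<lambda>k. c k + e k) \<longlonglongrightarrow> l"
    using tendsto_diff[OF tendsto_diff[OF x cd0] de0] by (simp add: algebra_simps)
  then show "l \<in> C"
    by (rule closed_sequentially[OF C(2), rotated]) (rule add_recession_cone[OF c e])
qed

theorem theorem4p9:
  fixes C :: "(real ^ 'n) set" and P :: "nat \<Rightarrow> (real ^ 'n) set"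
    and \<epsilon> \<delta> :: "nat \<Rightarrow> real"
  assumes "C \<noteq> {}" and "closed C" and "convex C" and "line_free C"
    and "\<And>\<nu>. eps_delta_approximation (\<epsilon> \<nu>) (\<delta> \<nu>) C (P \<nu>)"
    and "(\<lambda>\<nu>. (\<epsilon> \<nu>, \<delta> \<nu>)) \<longlonglongrightarrow> (0, 0)"
  shows "PK_converges P C"
proof -
  have "\<epsilon> \<longlonglongrightarrow> 0" "\<delta> \<longlonglongrightarrow> 0"
    using tendsto_fst[OF assms(6)] tendsto_snd[OF assms(6)] by simp_all
  then have "PK_outer_limit P \<subseteq> C"
    using PK_outer_limit_subset[where P = P and \<epsilon> = \<epsilon> and \<delta> = \<delta>, OF assms(1-5)] by blast
  moreover have "PK_inner_limit P \<subseteq> PK_outer_limit P"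
    unfolding PK_inner_limit_def PK_outer_limit_def frequently_cofinite[symmetric]
      cofinite_eq_sequentially
    using eventually_frequently[OF sequentially_bot] by blast
  moreover have "C \<subseteq> PK_inner_limit P"
  proof -
    have "C \<subseteq> P \<nu>" for \<nu>
      using assms(5) by (simp add: eps_delta_approximation_def)
    then show ?thesis
      unfolding PK_inner_limit_def by (fastforce intro: always_eventually)
  qed
  \<comment> \<open>The inclusions close the cycle from \<open>C\<close> through the inner and the
    outer limit back to \<open>C\<close>.\<close>
  ultimately show ?thesis
    unfolding PK_converges_def by blast
qed

end
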